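(* Let $d\ge1$, let $V$ be a real inner product space of finite dimension $n$, and let $m_1,m_2\in\mathbb{N}$. Let $(\mathbf{P}_1,\boldsymbol\pi_1)\in\mathcal{O}_{d,n}^{m_1}\times\Sigma_{m_1}^d$ and $(\mathbf{P}_2,\boldsymbol\pi_2)\in\mathcal{O}_{d,n}^{m_2}\times\Sigma_{m_2}^d$, with $\boldsymbol\pi_1=(\pi_{1,1},\dots,\pi_{1,d})$, $\boldsymbol\pi_2=(\pi_{2,1},\dots,\pi_{2,d})$, $\mathbf{P}_1=(P_1,\dots,P_{m_1})$, $\mathbf{P}_2=(P_{m_1+1},\dots,P_{m_1+m_2})$. Define $(\mathbf{P},\boldsymbol\pi)\in\mathcal{O}_{d,n}^{m_1+m_2}\times\Sigma_{m_1+m_2}^d$ by $\mathbf{P}=(P_1,\dots,P_{m_1+m_2})$ and $\boldsymbol\pi=(\pi_1,\dots,\pi_d)$, where $\pi_j\in\Sigma_{m_1+m_2}$ is given by $$\pi_j(i)=\begin{cases}\pi_{1,j}(i) & 1\le i\le m_1,\\ m_1+\pi_{2,j}(i-m_1) & m_1+1\le i\le m_1+m_2.\end{cases}$$ Then for every $\mathbf{x}\in\mathrm{Lip}(\square^d,V)$, $$\Phi_{m_1}^{\mathbf{P}_1,\boldsymbol\pi_1}(\mathbf{x})\,\Phi_{m_2}^{\mathbf{P}_2,\boldsymbol\pi_2}(\mathbf{x})=\sum_{\boldsymbol\sigma\in\mathrm{Sh}(m_1,m_2)^d}\Phi_{m_1+m_2}^{\mathbf{P},\boldsymbol\sigma\boldsymbol\pi}(\mathbf{x}),$$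 where $\boldsymbol\sigma\boldsymbol\pi=(\sigma_1\pi_1,\dots,\sigma_d\pi_d)$ denotes the component-wise group multiplication in $\Sigma_{m_1+m_2}^d$.
   Context: Notation: $\square^d=[0,1]^d$, $[k]=\{1,\dots,k\}$, $\Sigma_m$ is the symmetric group on $[m]$, with product $(\sigma\pi)(i)=\sigma(\pi(i))$. Fix an orthonormal basis of $V$ and write $\mathbf{x}=(x_1,\dots,x_n)$. $\mathrm{Lip}(\square^d,V)$ is the set of Lipschitz maps $\square^d\to V$ (differentiable a.e.). $\mathcal{O}_{d,n}$ is the set of order-preserving injections $P:[d]\to[n]$, and $J[\mathbf{x}_P](\mathbf{s})=\det\big(\partial x_{P(i)}/\partial s_j(\mathbf{s})\big)_{i,j\in[d]}$. For $\pi\in\Sigma_m$, $\Delta^m_\pi=\{0\le t_{\pi(1)}<\dots<t_{\pi(m)}\le1\}$. For $\boldsymbol\pi=(\pi_1,\dots,\pi_d)\in\Sigma_m^d$, $D^m_{\boldsymbol\pi}=\prod_{j=1}^d\Delta^m_{\pi_j}$, with coordinates $\mathbf{t}=(t_{i,j})_{i\in[m],j\in[d]}$ such that $(t_{1,j},\dots,t_{m,j})\in\Delta^m_{\pi_j}$, and $\mathbf{t}_i=(t_{i,1},\dots,t_{i,d})$. For $(\mathbf{P},\boldsymbol\pi)\in\mathcal{O}_{d,n}^m\times\Sigma_m^d$ with $\mathbf{P}=(P_1,\dots,P_m)$, the mapping space monomial is $\Phi_m^{\mathbf{P},\boldsymbol\pi}(\mathbf{x})=\int_{D^m_{\boldsymbol\pi}}\prod_{i=1}^mJ[\mathbf{x}_{P_i}](\mathbf{t}_i)\,d\mathbf{t}$.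 $\mathrm{Sh}(p,q)\subset\Sigma_{p+q}$ is the set of $(p,q)$-shuffles, i.e. of $\sigma$ with $\sigma^{-1}(1)<\dots<\sigma^{-1}(p)$ and $\sigma^{-1}(p+1)<\dots<\sigma^{-1}(p+q)$.
   Formalization: The sum is taken over the products $\pi_j\sigma_j$ instead of $\sigma_j\pi_j$; with $(\sigma\pi)(i)=\sigma(\pi(i))$ the stated order fails, e.g. for $d=1$, $m_1=2$, $m_2=1$, $\pi=213$ and a path moving along $e_3$, then $e_2$, then $e_1$. *)

theory Defs
  imports "HOL-Analysis.Analysis"
begin

text \<open>
  The index set \<open>[d]\<close> is a finite linearly ordered type \<^typ>\<open>'d\<close>, so the unit cube is
  \<open>cbox 0 1 :: (real^'d) set\<close>. The number \<open>m\<close> of factors varies, so points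
  \<open>(t\<^sub>i\<^sub>,\<^sub>j)\<close> are functions \<open>t :: nat \<Rightarrow> real^'d\<close> on \<open>{1..m}\<close>
  with \<open>t\<^sub>i\<^sub>,\<^sub>j = t i $ j\<close>. Permutations of \<open>[m]\<close> are functions
  permuting \<open>{1..m}\<close>; their product is composition, \<open>(\<sigma> \<circ> \<pi>) i = \<sigma> (\<pi> i)\<close>.
\<close>

definition is_onb :: "nat \<Rightarrow> (nat \<Rightarrow> 'v::real_inner) \<Rightarrow> bool" where
  "is_onb n e \<longleftrightarrow>
     (\<forall>i\<in>{1..n}. \<forall>k\<in>{1..n}. e i \<bullet> e k = (if i = k then 1 else 0)) \<and>
     span (e ` {1..n}) = UNIV"

definition lip_cube :: "(real^'d \<Rightarrow> 'v::real_inner) set" where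
  "lip_cube = {x. \<exists>L. L-lipschitz_on (cbox 0 1) x}"

definition order_inj :: "nat \<Rightarrow> ('d::{finite,linorder} \<Rightarrow> nat) set" where
  "order_inj n = {P. strict_mono P \<and> range P \<subseteq> {1..n}}"

text \<open>
  The partial derivative is taken within \<open>[0,1]\<close>, so that on the cube it depends only on the
  restriction of \<open>f\<close> to the cube. Where it does not exist (a null set for Lipschitz \<open>f\<close>)
  the value is arbitrary.
\<close>
definition partial :: "'d::finite \<Rightarrow> (real^'d::finite \<Rightarrow> real) \<Rightarrow> real^'d::finite \<Rightarrow> real" where
  "partial j f s =
     vector_derivative (\<lambda>u. f (\<chi> k. if k = j then u else s $ k)) (at (s $ j) within {0..1})"

definition jac_minor ::
    "(nat \<Rightarrow> 'v::real_inner) \<Rightarrow> ((real^'d::{finite,linorder}) \<Rightarrow> 'v)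
      \<Rightarrow> ('d::{finite,linorder} \<Rightarrow> nat) \<Rightarrow> (real^'d::{finite,linorder}) \<Rightarrow> real" where
  "jac_minor e x P s = det (\<chi> i j. partial j (\<lambda>u. e (P i) \<bullet> x u) s)"

definition simplex_perm :: "nat \<Rightarrow> (nat \<Rightarrow> nat) \<Rightarrow> (nat \<Rightarrow> real) set" where
  "simplex_perm m \<pi> =
     {u. (\<forall>i\<in>{1..m}. 0 \<le> u i \<and> u i \<le> 1) \<and> strict_mono_on {1..m} (\<lambda>i. u (\<pi> i))}"

definition prod_simplex :: "nat \<Rightarrow> ('d::finite \<Rightarrow> nat \<Rightarrow> nat) \<Rightarrow> (nat \<Rightarrow> real^'d::finite) set" where
  "prod_simplex m \<pi> = {t. \<forall>j. (\<lambda>i. t i $ j) \<in> simplex_perm m (\<pi> j)}"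

text \<open>
  The measure is Lebesgue measure on \<open>(\<real>\<^sup>d)\<^sup>m\<close>. It has to be the completion: the product
  measure lives on a sigma-algebra for which arbitrary values of the integrand on a null set could
  destroy measurability, and the Bochner integral would then be \<open>0\<close> by convention.
\<close>
definition mapping_monomial ::
    "(nat \<Rightarrow> 'v::real_inner) \<Rightarrow> nat \<Rightarrow> (nat \<Rightarrow> 'd::{finite,linorder} \<Rightarrow> nat)
      \<Rightarrow> ('d::{finite,linorder} \<Rightarrow> nat \<Rightarrow> nat)
      \<Rightarrow> ((real^'d::{finite,linorder}) \<Rightarrow> 'v) \<Rightarrow> real" where
  "mapping_monomial e m P \<pi> x =
     (LINT t : prod_simplex m \<pi> | completion (PiM {1..m} (\<lambda>_. lborel)).
        (\<Prod>i=1..m. jac_minor e x (P i) (t i)))"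

definition concat_seq :: "nat \<Rightarrow> (nat \<Rightarrow> 'a) \<Rightarrow> (nat \<Rightarrow> 'a) \<Rightarrow> nat \<Rightarrow> 'a" where
  "concat_seq m P Q i = (if i \<le> m then P i else Q (i - m))"

definition perm_sum :: "nat \<Rightarrow> (nat \<Rightarrow> nat) \<Rightarrow> (nat \<Rightarrow> nat) \<Rightarrow> nat \<Rightarrow> nat" where
  "perm_sum m \<pi> \<rho> i = (if i \<le> m then \<pi> i else m + \<rho> (i - m))"

text \<open>
  A shuffle \<open>\<sigma>\<close>, read as the word \<open>\<sigma> 1, \<dots>, \<sigma> (p + q)\<close>, lists each of the blocks
  \<open>1, \<dots>, p\<close> and \<open>p + 1, \<dots>, p + q\<close> in increasing order. To obtain the words listing the
  blocks in the orders \<open>\<pi> 1, \<dots>, \<pi> p\<close> and \<open>\<pi> (p + 1), \<dots>, \<pi> (p + q)\<close>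
  one relabels the letters, which for this product is \<open>\<pi> \<circ> \<sigma>\<close>, not \<open>\<sigma> \<circ> \<pi>\<close>.
\<close>
definition Sh :: "nat \<Rightarrow> nat \<Rightarrow> (nat \<Rightarrow> nat) set" where
  "Sh p q = {\<sigma>. \<sigma> permutes {1..p+q} \<and>
     strict_mono_on {1..p} (inv \<sigma>) \<and> strict_mono_on {p+1..p+q} (inv \<sigma>)}"

lemma perm_sum_permutes:
  assumes p: "\<pi> permutes {1..m}" and r: "\<rho> permutes {1..n}"
  shows "perm_sum m \<pi> \<rho> permutes {1..m+n}"
proof (rule bij_imp_permutes)
  have pm: "\<pi> i \<in> {1..m}" if "i \<in> {1..m}" for i using that permutes_in_image[OF p] by blast
  have rn: "\<rho> i \<in> {1..n}" if "i \<in> {1..n}" for i using that permutes_in_image[OF r] by blast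
  have maps: "perm_sum m \<pi> \<rho> i \<in> {1..m+n}" if "i \<in> {1..m+n}" for i
    using that pm[of i] rn[of "i - m"] by (cases "i \<le> m") (auto simp: perm_sum_def Suc_le_eq le_diff_conv add.commute)
  have inj: "inj_on (perm_sum m \<pi> \<rho>) {1..m+n}"
  proof (rule inj_onI)
    fix i k assume ik: "i \<in> {1..m+n}" "k \<in> {1..m+n}" and eq: "perm_sum m \<pi> \<rho> i = perm_sum m \<pi> \<rho> k"
    have pi: "\<pi> i = \<pi> k \<Longrightarrow> i = k" using permutes_inj[OF p] by (auto dest: injD)
    have rho: "\<rho> (i - m) = \<rho> (k - m) \<Longrightarrow> i - m = k - m" using permutes_inj[OF r] by (auto dest: injD)
    show "i = k"
      using ik eq pi rho pm[of i] pm[of k] rn[of "i - m"] rn[of "k - m"]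
      by (cases "i \<le> m"; cases "k \<le> m") (auto simp: perm_sum_def Suc_le_eq le_diff_conv add.commute)
  qed
  show "bij_betw (perm_sum m \<pi> \<rho>) {1..m+n} {1..m+n}"
    using inj maps by (simp add: bij_betw_def endo_inj_surj image_subset_iff)
next
  fix i assume i: "i \<notin> {1..m+n}"
  show "perm_sum m \<pi> \<rho> i = i"
  proof (cases "i \<le> m")
    case True
    then have "i \<notin> {1..m}" using i by auto
    then show ?thesis using True permutes_not_in[OF p] by (simp add: perm_sum_def)
  next
    case False
    then have "i - m \<notin> {1..n}" using i by auto
    then show ?thesis using False permutes_not_in[OF r] by (simp add: perm_sum_def)
  qed
qed

lemma finite_Sh: "finite (Sh p q)"
  by (rule finite_subset[OF _ finite_permutations[of "{1..p+q}"]]) (auto simp: Sh_def)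

end

theory Submission
  imports Defs
begin

text \<open>
  By Fubini the product of the two monomials is one integral over the product of the two domains.
  Off the null set where two of the points share a coordinate, the numbers
  \<open>t\<^sub>1\<^sub>,\<^sub>j, \<dots>, t\<^sub>m\<^sub>,\<^sub>j\<close> are sorted by exactly one permutation for each \<open>j\<close>, and this
  permutation is \<open>\<pi>\<^sub>j \<circ> \<sigma>\<^sub>j\<close> for a shuffle \<open>\<sigma>\<^sub>j\<close> exactly when the two blocks are
  sorted by \<open>\<pi>\<^sub>1\<^sub>,\<^sub>j\<close> and \<open>\<pi>\<^sub>2\<^sub>,\<^sub>j\<close>. So the domain is the disjoint union of the domains on
  the right-hand side up to a null set.
\<close>

subsection \<open>Sorting and shuffles\<close>

text \<open>When \<open>v\<close> is injective, the inverse of this function is the permutation that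
  sorts \<open>v\<close>. Counting with \<open>\<le>\<close> makes ranks start at 1, and being the
  identity outside \<open>{1..N}\<close> is what \<open>permutes\<close> demands.\<close>

definition val_rank :: "nat \<Rightarrow> (nat \<Rightarrow> real) \<Rightarrow> nat \<Rightarrow> nat" where
  "val_rank N v i = (if i \<in> {1..N} then card {k\<in>{1..N}. v k \<le> v i} else i)"

text \<open>The lower sets \<open>{l. v l \<le> v i}\<close> form a chain, and for
  \<open>v i < v k\<close> the index \<open>k\<close> lies in its own lower set but not in that of
  \<open>i\<close>.\<close>

lemma val_rank_less_iff:
  assumes "i \<in> {1..N}" "k \<in> {1..N}"
  shows "val_rank N v i < val_rank N v k \<longleftrightarrow> v i < v k"
proof
  assume "v i < v k"
  then have "k \<in> {l\<in>{1..N}. v l \<le> v k} - {l\<in>{1..N}. v l \<le> v i}"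
    "{l\<in>{1..N}. v l \<le> v i} \<subseteq> {l\<in>{1..N}. v l \<le> v k}"
    using assms by auto
  then have "{l\<in>{1..N}. v l \<le> v i} \<subset> {l\<in>{1..N}. v l \<le> v k}" by blast
  then show "val_rank N v i < val_rank N v k"
    using assms by (simp add: val_rank_def psubset_card_mono)
next
  assume less: "val_rank N v i < val_rank N v k"
  show "v i < v k"
  proof (rule ccontr)
    assume "\<not> v i < v k"
    then have "{l\<in>{1..N}. v l \<le> v k} \<subseteq> {l\<in>{1..N}. v l \<le> v i}" by auto
    then have "val_rank N v k \<le> val_rank N v i"
      using assms by (simp add: val_rank_def card_mono)
    with less show False by simp
  qed
qed

text \<open>Each index counts itself, so ranks are positive; equal ranks force equal values; an
  injective self-map of a finite set is bijective.\<close>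

lemma val_rank_permutes:
  assumes inj: "inj_on v {1..N}"
  shows "val_rank N v permutes {1..N}"
proof (rule bij_imp_permutes)
  have maps: "val_rank N v ` {1..N} \<subseteq> {1..N}"
  proof
    fix r assume "r \<in> val_rank N v ` {1..N}"
    then obtain i where i: "i \<in> {1..N}" "r = card {k\<in>{1..N}. v k \<le> v i}"
      by (auto simp: val_rank_def)
    have "card {k\<in>{1..N}. v k \<le> v i} \<le> card {1..N}" by (rule card_mono) auto
    moreover have "0 < card {k\<in>{1..N}. v k \<le> v i}" using i by (auto simp: card_gt_0_iff)
    ultimately show "r \<in> {1..N}" using i by simp
  qed
  have "inj_on (val_rank N v) {1..N}"
  proof (rule inj_onI)
    fix i k assume ik: "i \<in> {1..N}" "k \<in> {1..N}" and "val_rank N v i = val_rank N v k"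
    then have "v i = v k"
      using val_rank_less_iff[OF ik, of v] val_rank_less_iff[OF ik(2,1), of v] by simp
    then show "i = k" using inj ik by (auto dest: inj_onD)
  qed
  then show "bij_betw (val_rank N v) {1..N} {1..N}"
    using maps by (simp add: bij_betw_def endo_inj_surj)
qed (auto simp: val_rank_def)

lemma strict_mono_on_comp_inv_val_rank:
  assumes "inj_on v {1..N}"
  shows "strict_mono_on {1..N} (v \<circ> inv (val_rank N v))"
proof (rule strict_mono_onI)
  note perm = val_rank_permutes[OF assms]
  fix a b assume ab: "a \<in> {1..N}" "b \<in> {1..N}" "a < (b::nat)"
  then have "inv (val_rank N v) a \<in> {1..N}" "inv (val_rank N v) b \<in> {1..N}"
    using permutes_in_image[OF permutes_inv[OF perm]] by blast+
  from val_rank_less_iff[OF this, of v] ab(3)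
  show "(v \<circ> inv (val_rank N v)) a < (v \<circ> inv (val_rank N v)) b"
    by (simp add: permutes_inverses[OF perm])
qed

text \<open>Uniqueness of sorting: the indices whose value is at most \<open>v (\<sigma> a)\<close>
  are exactly \<open>\<sigma> 1, ..., \<sigma> a\<close>, so \<open>\<sigma> a\<close> has rank
  \<open>a\<close>.\<close>

lemma strict_mono_on_comp_imp_eq_inv_val_rank:
  assumes \<sigma>: "\<sigma> permutes {1..N}" and mono: "strict_mono_on {1..N} (v \<circ> \<sigma>)"
  shows "\<sigma> = inv (val_rank N v)"
proof -
  have rank: "val_rank N v (\<sigma> a) = a" for a
  proof (cases "a \<in> {1..N}")
    case True
    have "{k\<in>{1..N}. v k \<le> v (\<sigma> a)} = \<sigma> ` {1..a}"
    proof (intro set_eqI iffI)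
      fix k assume k: "k \<in> {k\<in>{1..N}. v k \<le> v (\<sigma> a)}"
      then obtain b where b: "b \<in> {1..N}" "k = \<sigma> b" using permutes_image[OF \<sigma>] by blast
      then have "b \<le> a"
        using k strict_mono_on_less[OF mono True b(1)] by auto
      then show "k \<in> \<sigma> ` {1..a}" using b by auto
    next
      fix k assume "k \<in> \<sigma> ` {1..a}"
      then obtain b where b: "b \<in> {1..a}" "k = \<sigma> b" by blast
      then have "b \<in> {1..N}" using True by auto
      then show "k \<in> {k\<in>{1..N}. v k \<le> v (\<sigma> a)}"
        using b True strict_mono_on_less_eq[OF mono \<open>b \<in> {1..N}\<close> True] permutes_in_image[OF \<sigma>, of b]
        by auto
    qed
    moreover have "card (\<sigma> ` {1..a}) = a"
      by (subst card_image) (auto intro: inj_on_subset[OF permutes_inj[OF \<sigma>]])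
    moreover have "\<sigma> a \<in> {1..N}" using True permutes_in_image[OF \<sigma>] by blast
    ultimately show ?thesis by (simp add: val_rank_def)
  next
    case False
    then show ?thesis using permutes_not_in[OF \<sigma> False] unfolding val_rank_def by (simp only: if_False)
  qed
  then have "val_rank N v = inv \<sigma>"
    by (metis \<sigma> permutes_inverses(1) ext)
  then show ?thesis by (simp add: permutes_inv_inv[OF \<sigma>])
qed

section \<open>Shuffles and the sorting of two blocks\<close>

lemma atLeastAtMost_add_eq: "{1..m + n} = {1..m} \<union> (+) m ` {1..n::nat}"
  by (auto simp: image_add_atLeastAtMost)

lemma ball_atLeastAtMost_add:
  "(\<forall>i\<in>{1..m + n::nat}. Q i) \<longleftrightarrow> (\<forall>i\<in>{1..m}. Q i) \<and> (\<forall>i\<in>{1..n}. Q (m + i))"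
  unfolding atLeastAtMost_add_eq by (simp only: ball_Un ball_simps)

lemma perm_sum_le: "i \<le> m \<Longrightarrow> perm_sum m \<pi> \<rho> i = \<pi> i"
  by (simp add: perm_sum_def)

lemma perm_sum_add: "i \<ge> 1 \<Longrightarrow> perm_sum m \<pi> \<rho> (m + i) = m + \<rho> i"
  by (simp add: perm_sum_def)

lemma strict_mono_on_shift_iff:
  fixes v :: "nat \<Rightarrow> 'a::order"
  shows "strict_mono_on {m + 1..m + n} v \<longleftrightarrow> strict_mono_on {1..n} (\<lambda>i. v (m + i))"
proof
  assume "strict_mono_on {m + 1..m + n} v"
  then show "strict_mono_on {1..n} (\<lambda>i. v (m + i))" by (auto simp: strict_mono_on_def)
next
  assume *: "strict_mono_on {1..n} (\<lambda>i. v (m + i))"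
  show "strict_mono_on {m + 1..m + n} v"
  proof (rule strict_mono_onI)
    fix a b assume "a \<in> {m + 1..m + n}" "b \<in> {m + 1..m + n}" "a < b"
    then show "v a < v b"
      using strict_mono_onD[OF *, of "a - m" "b - m"] by auto
  qed
qed

text \<open>\<open>Sh\<close> constrains the inverse of a permutation. Here that inverse is the rank
  function, which increases on exactly those subsets of \<open>{1..m + n}\<close> where
  \<open>v\<close> does.\<close>

lemma inv_val_rank_in_Sh_iff:
  assumes inj: "inj_on v {1..m + n}"
  shows "inv (val_rank (m + n) v) \<in> Sh m n \<longleftrightarrow>
    strict_mono_on {1..m} v \<and> strict_mono_on {1..n} (\<lambda>i. v (m + i))"
proof -
  note perm = val_rank_permutes[OF inj]
  have sm: "strict_mono_on A (val_rank (m + n) v) \<longleftrightarrow> strict_mono_on A v" if "A \<subseteq> {1..m + n}" for A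
    using that by (auto simp: strict_mono_on_def val_rank_less_iff subset_iff)
  have "{1..m} \<subseteq> {1..m + n}" "{m + 1..m + n} \<subseteq> {1..m + n}" by auto
  then show ?thesis
    unfolding Sh_def strict_mono_on_shift_iff[symmetric] mem_Collect_eq permutes_inv_inv[OF perm]
    using permutes_inv[OF perm] sm by blast
qed

text \<open>This treats one coordinate direction. Sorting \<open>u\<close> by
  \<open>perm_sum m \<pi> \<rho> \<circ> \<sigma>\<close> means sorting the relabelled
  \<open>v = u \<circ> perm_sum m \<pi> \<rho>\<close> by \<open>\<sigma>\<close>. Only the inverse
  rank of \<open>v\<close> does so, and it is a shuffle exactly when \<open>v\<close> increases
  along both blocks.\<close>

lemma simplex_perm_perm_sum_iff:
  fixes u :: "nat \<Rightarrow> real"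
  assumes inj: "inj_on u {1..m + n}"
    and \<pi>: "\<pi> permutes {1..m}" and \<rho>: "\<rho> permutes {1..n}"
  shows "\<sigma> \<in> Sh m n \<and> u \<in> simplex_perm (m + n) (perm_sum m \<pi> \<rho> \<circ> \<sigma>) \<longleftrightarrow>
    \<sigma> = inv (val_rank (m + n) (u \<circ> perm_sum m \<pi> \<rho>)) \<and>
    u \<in> simplex_perm m \<pi> \<and> (\<lambda>i. u (m + i)) \<in> simplex_perm n \<rho>"
proof -
  define v where "v = u \<circ> perm_sum m \<pi> \<rho>"
  note ps = perm_sum_permutes[OF \<pi> \<rho>]
  have inj_v: "inj_on v {1..m + n}"
    unfolding v_def
    by (rule comp_inj_on) (use inj permutes_image[OF ps] permutes_inj_on[OF ps] in auto)
  have blocks: "strict_mono_on {1..m} v \<longleftrightarrow> strict_mono_on {1..m} (\<lambda>i. u (\<pi> i))"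
    "strict_mono_on {1..n} (\<lambda>i. v (m + i)) \<longleftrightarrow> strict_mono_on {1..n} (\<lambda>i. u (m + \<rho> i))"
    by (auto simp: v_def strict_mono_on_def perm_sum_le perm_sum_add)
  have "\<sigma> \<in> Sh m n \<and> strict_mono_on {1..m + n} (v \<circ> \<sigma>) \<longleftrightarrow>
      \<sigma> = inv (val_rank (m + n) v) \<and> inv (val_rank (m + n) v) \<in> Sh m n"
    using strict_mono_on_comp_imp_eq_inv_val_rank[of \<sigma> "m + n" v] strict_mono_on_comp_inv_val_rank[OF inj_v]
    by (auto simp: Sh_def)
  moreover have "(v \<circ> \<sigma>) = (\<lambda>i. u ((perm_sum m \<pi> \<rho> \<circ> \<sigma>) i))"
    by (auto simp: v_def)
  ultimately show ?thesis
    unfolding simplex_perm_def inv_val_rank_in_Sh_iff[OF inj_v] blocks v_def[symmetric] mem_Collect_eq ball_atLeastAtMost_add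
    by auto
qed

text \<open>Where no two points share a coordinate, the one-direction statement determines every
  \<open>\<sigma> j\<close>, so at most one summand is nonzero.\<close>

lemma sum_indicator_prod_simplex:
  fixes t :: "nat \<Rightarrow> real^'d::finite" and \<pi> \<rho> :: "'d \<Rightarrow> nat \<Rightarrow> nat"
  assumes inj: "\<And>j. inj_on (\<lambda>i. t i $ j) {1..m + n}"
    and \<pi>: "\<And>j. \<pi> j permutes {1..m}" and \<rho>: "\<And>j. \<rho> j permutes {1..n}"
  shows "(\<Sum>\<sigma> | \<forall>j. \<sigma> j \<in> Sh m n.
      indicator (prod_simplex (m + n) (\<lambda>j. perm_sum m (\<pi> j) (\<rho> j) \<circ> \<sigma> j)) t) =
    indicator (prod_simplex m \<pi>) t * (indicator (prod_simplex n \<rho>) (\<lambda>i. t (m + i)) :: real)"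
    (is "sum ?f ?S = ?R")
proof -
  have fin: "finite ?S"
    using finite_PiE[of UNIV "\<lambda>_::'d. Sh m n"] by (simp add: finite_Sh PiE_UNIV_domain Pi_def)
  define \<tau> where "\<tau> j = inv (val_rank (m + n) ((\<lambda>i. t i $ j) \<circ> perm_sum m (\<pi> j) (\<rho> j)))" for j
  define A where "A \<longleftrightarrow> t \<in> prod_simplex m \<pi> \<and> (\<lambda>i. t (m + i)) \<in> prod_simplex n \<rho>"
  have eq: "\<sigma> \<in> ?S \<and> t \<in> prod_simplex (m + n) (\<lambda>j. perm_sum m (\<pi> j) (\<rho> j) \<circ> \<sigma> j)
      \<longleftrightarrow> \<sigma> = \<tau> \<and> A" for \<sigma>
    using simplex_perm_perm_sum_iff[OF inj \<pi> \<rho>]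
    unfolding prod_simplex_def A_def \<tau>_def fun_eq_iff[of \<sigma>] mem_Collect_eq by metis
  have "sum ?f ?S = real (card {\<sigma>\<in>?S. t \<in> prod_simplex (m + n) (\<lambda>j. perm_sum m (\<pi> j) (\<rho> j) \<circ> \<sigma> j)})"
    using fin by (simp add: indicator_def sum.If_cases Int_def)
  also have "{\<sigma>\<in>?S. t \<in> prod_simplex (m + n) (\<lambda>j. perm_sum m (\<pi> j) (\<rho> j) \<circ> \<sigma> j)} =
      (if A then {\<tau>} else {})"
    using eq by auto
  also have "real (card \<dots>) = ?R"
    by (simp add: A_def indicator_def)
  finally show ?thesis .
qed

subsection \<open>Jacobian minors of Lipschitz maps\<close>

text \<open>Names the argument of \<open>f\<close> inside \<open>partial\<close>, so that the
  partial derivative is that of a real function along an axis-parallel line.\<close>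

definition line :: "'d \<Rightarrow> real^'d::finite \<Rightarrow> real \<Rightarrow> real^'d" where
  "line j s u = (\<chi> k. if k = j then u else s $ k)"

lemma line_in_cube:
  assumes "s \<in> cbox 0 1" "u \<in> {0..1}"
  shows "line j s u \<in> cbox 0 1"
  using assms by (auto simp: line_def mem_box_cart)

lemma line_same [simp]: "line j s (s $ j) = s"
  by (auto simp: line_def vec_eq_iff)

lemma dist_line: "dist (line j s u) (line j s v) = \<bar>u - v\<bar>"
proof -
  have "line j s u - line j s v = axis j (u - v)"
    by (auto simp: line_def axis_def vec_eq_iff)
  then show ?thesis by (simp add: dist_norm norm_eq_sqrt_inner[of "axis j _"] inner_axis_axis)
qed

lemma continuous_on_line [continuous_intros]:
  assumes "continuous_on S f" "continuous_on S g"
  shows "continuous_on S (\<lambda>x. line j (f x) (g x))"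
  unfolding line_def
proof (intro continuous_on_vec_lambda)
  fix k
  show "continuous_on S (\<lambda>x. if k = j then g x else f x $ k)"
    by (cases "k = j") (auto intro!: continuous_intros assms)
qed

text \<open>Within \<open>{0..1}\<close> the line through a point of the cube stays in the cube. The
  derivative predicates therefore coincide, and with them the chosen values where no derivative
  exists.\<close>

lemma partial_cong_cube:
  fixes f g :: "real^'d::finite \<Rightarrow> real"
  assumes "\<And>s. s \<in> cbox 0 1 \<Longrightarrow> f s = g s" and s: "s \<in> cbox 0 1"
  shows "partial j f s = partial j g s"
proof -
  have sj: "s $ j \<in> {0..1}" using s by (auto simp: mem_box_cart)
  note eq = assms(1)[OF line_in_cube[OF s]]
  have "((\<lambda>u. f (line j s u)) has_vector_derivative D) (at (s $ j) within {0..1}) \<longleftrightarrow>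
    ((\<lambda>u. g (line j s u)) has_vector_derivative D) (at (s $ j) within {0..1})" for D
  proof
    show "((\<lambda>u. g (line j s u)) has_vector_derivative D) (at (s $ j) within {0..1})"
      if "((\<lambda>u. f (line j s u)) has_vector_derivative D) (at (s $ j) within {0..1})"
      by (rule has_vector_derivative_transform[OF sj _ that]) (simp add: eq)
    show "((\<lambda>u. f (line j s u)) has_vector_derivative D) (at (s $ j) within {0..1})"
      if "((\<lambda>u. g (line j s u)) has_vector_derivative D) (at (s $ j) within {0..1})"
      by (rule has_vector_derivative_transform[OF sj _ that]) (simp add: eq)
  qed
  then show ?thesis
    by (simp add: partial_def vector_derivative_def line_def)
qed

section \<open>Borel measurability of partial derivatives\<close>

text \<open>Turns differentiability into a countable condition, suitable for measurability:
  tolerances may be reciprocals of integers, and by continuity an estimate at rational points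
  extends to the whole interval.\<close>

lemma has_vector_derivative_within_unit_iff_rat:
  fixes h :: "real \<Rightarrow> real"
  assumes cont: "continuous_on {0..1} h" and x: "x \<in> {0..1}"
  shows "(h has_vector_derivative D) (at x within {0..1}) \<longleftrightarrow>
    (\<forall>n. \<exists>k. \<forall>q::rat. 0 \<le> real_of_rat q \<and> real_of_rat q \<le> 1 \<and>
        \<bar>real_of_rat q - x\<bar> < inverse (real (Suc k)) \<longrightarrow>
      \<bar>h (of_rat q) - h x - D * (of_rat q - x)\<bar> \<le> inverse (real (Suc n)) * \<bar>of_rat q - x\<bar>)"
    (is "?L \<longleftrightarrow> ?R")
proof -
  have L: "?L \<longleftrightarrow> (\<forall>e>0. \<exists>d>0. \<forall>y\<in>{0..1}. \<bar>y - x\<bar> < d \<longrightarrow> \<bar>h y - h x - D * (y - x)\<bar> \<le> e * \<bar>y - x\<bar>)"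
    unfolding has_vector_derivative_def has_derivative_within_alt
    using bounded_linear_scaleR_left[of D] by (simp add: mult.commute)
  show ?thesis
  proof
    assume ?L
    show ?R
    proof
      fix n
      obtain d where d: "d > 0" "\<forall>y\<in>{0..1}. \<bar>y - x\<bar> < d \<longrightarrow> \<bar>h y - h x - D * (y - x)\<bar> \<le> inverse (real (Suc n)) * \<bar>y - x\<bar>"
        using \<open>?L\<close> unfolding L by (meson inverse_positive_iff_positive of_nat_0_less_iff zero_less_Suc)
      obtain k where k: "inverse (real (Suc k)) < d" using reals_Archimedean[OF d(1)] by blast
      show "\<exists>k. \<forall>q::rat. 0 \<le> real_of_rat q \<and> real_of_rat q \<le> 1 \<and>
        \<bar>real_of_rat q - x\<bar> < inverse (real (Suc k)) \<longrightarrow>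
      \<bar>h (of_rat q) - h x - D * (of_rat q - x)\<bar> \<le> inverse (real (Suc n)) * \<bar>of_rat q - x\<bar>"
        by (rule exI[of _ k]) (use k d(2) in \<open>auto simp del: of_nat_Suc\<close>)
    qed
  next
    assume ?R
    show ?L
      unfolding L
    proof (intro allI impI)
      fix e :: real assume "e > 0"
      then obtain n where n: "inverse (real (Suc n)) < e" using reals_Archimedean by blast
      from \<open>?R\<close> obtain k where k: "\<And>q::rat. 0 \<le> real_of_rat q \<Longrightarrow> real_of_rat q \<le> 1 \<Longrightarrow>
        \<bar>real_of_rat q - x\<bar> < inverse (real (Suc k)) \<Longrightarrow>
        \<bar>h (of_rat q) - h x - D * (of_rat q - x)\<bar> \<le> inverse (real (Suc n)) * \<bar>of_rat q - x\<bar>"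
        by meson
      define d where "d = inverse (real (Suc k))"
      have dpos: "d > 0" by (simp add: d_def)
      have "\<bar>h y - h x - D * (y - x)\<bar> \<le> e * \<bar>y - x\<bar>" if y: "y \<in> {0..1}" "\<bar>y - x\<bar> < d" for y
      proof -
        \<comment> \<open>Rationals are dense in open sets, hence the open intervals; the closure
          still contains \<open>y\<close>, even if \<open>y\<close> is an endpoint of
          \<open>[0,1]\<close>.\<close>
        let ?Q = "{0<..<1} \<inter> {x - d<..<x + d}"
        have "y \<in> closure ?Q"
        proof -
          have ne: "{0<..<1} \<inter> {x - d<..<x + d} = {max 0 (x - d)<..<min 1 (x + d)}" by auto
          have "max 0 (x - d) < min 1 (x + d)" using x dpos by auto
          then have "closure ?Q = {max 0 (x - d)..min 1 (x + d)}"
            unfolding ne by (rule closure_greaterThanLessThan)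
          then show ?thesis using y by auto
        qed
        also have "closure ?Q = closure ((({0<..<1} \<inter> {x - d<..<x + d})) \<inter> range real_of_rat)"
        proof -
          have "closure (range real_of_rat) = UNIV"
            unfolding closure_approachable set_eq_iff
            by (auto simp: dist_real_def) (metis abs_of_pos add_diff_cancel_left' diff_gt_0_iff_gt less_add_same_cancel1 of_rat_dense diff_less_eq add.commute)
          then show ?thesis
            by (intro closure_open_Int_superset[symmetric]) (auto)
        qed
        finally obtain r where r: "\<And>n. r n \<in> ({0<..<1} \<inter> {x - d<..<x + d}) \<inter> range real_of_rat" "r \<longlonglongrightarrow> y"
          unfolding closure_sequential by blast
        have le: "\<bar>h (r i) - h x - D * (r i - x)\<bar> \<le> e * \<bar>r i - x\<bar>" for i
        proof -
          obtain q where q: "r i = real_of_rat q" using r(1)[of i] by auto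
          have "\<bar>h (r i) - h x - D * (r i - x)\<bar> \<le> inverse (real (Suc n)) * \<bar>r i - x\<bar>"
            unfolding q by (rule k) (use r(1)[of i] q in \<open>auto simp: d_def[symmetric] simp del: of_nat_Suc\<close>)
          also have "\<dots> \<le> e * \<bar>r i - x\<bar>" using n by (intro mult_right_mono) auto
          finally show ?thesis .
        qed
        \<comment> \<open>Both sides of the estimate converge along \<open>r\<close>, and a
          nonstrict inequality survives the limit.\<close>
        have "(\<lambda>i. h (r i)) \<longlonglongrightarrow> h y"
          by (rule continuous_on_tendsto_compose[OF cont r(2) y(1)])
            (use r(1) in \<open>auto simp: less_imp_le\<close>)
        then have "(\<lambda>i. \<bar>h (r i) - h x - D * (r i - x)\<bar>) \<longlonglongrightarrow> \<bar>h y - h x - D * (y - x)\<bar>"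
          by (intro tendsto_intros r(2))
        moreover have "(\<lambda>i. e * \<bar>r i - x\<bar>) \<longlonglongrightarrow> e * \<bar>y - x\<bar>"
          by (intro tendsto_intros r(2))
        ultimately show ?thesis
          by (rule LIMSEQ_le) (use le in auto)
      qed
      then show "\<exists>d>0. \<forall>y\<in>{0..1}. \<bar>y - x\<bar> < d \<longrightarrow> \<bar>h y - h x - D * (y - x)\<bar> \<le> e * \<bar>y - x\<bar>"
        using dpos by blast
    qed
  qed
qed

text \<open>A sequence in \<open>[0,1]\<close> that avoids \<open>a\<close>, tends to
  \<open>a\<close> and is Borel in \<open>a\<close>. It steps right from the left half and left from
  the right half; \<open>n + 2\<close> keeps the step at most 1/2, so it never leaves the
  interval.\<close>

definition unit_step :: "nat \<Rightarrow> real \<Rightarrow> real" where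
  "unit_step n a = a + (if a \<le> 1/2 then 1 else - 1) / real (n + 2)"

lemma unit_step_ne: "unit_step n a \<noteq> a"
  by (simp add: unit_step_def field_simps)

lemma unit_step_mem: "a \<in> {0..1} \<Longrightarrow> unit_step n a \<in> {0..1}"
proof -
  have "0 \<le> 1 / real (n + 2)" "1 / real (n + 2) \<le> 1 / 2" by (auto simp: field_simps)
  then show "a \<in> {0..1} \<Longrightarrow> unit_step n a \<in> {0..1}"
    unfolding unit_step_def atLeastAtMost_iff by (cases "a \<le> 1 / 2") (simp_all only: if_True if_False minus_divide_left[symmetric], linarith+)
qed

lemma unit_step_tendsto: "(\<lambda>n. unit_step n a) \<longlonglongrightarrow> a"
proof -
  have "(\<lambda>n. a + (if a \<le> 1/2 then 1 else - 1) / real (n + 2)) \<longlonglongrightarrow> a + 0"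
    by (intro tendsto_add tendsto_const LIMSEQ_ignore_initial_segment lim_const_over_n)
  then show ?thesis by (simp add: unit_step_def)
qed

lemma borel_measurable_unit_step [measurable]: "unit_step n \<in> borel_measurable borel"
  unfolding unit_step_def[abs_def] by measurable

text \<open>A derivative that exists can be read off from one fixed sequence of difference
  quotients, which supplies a measurable candidate for it.\<close>

lemma has_vector_derivative_imp_lim_unit_step:
  fixes h :: "real \<Rightarrow> real"
  assumes "(h has_vector_derivative D) (at a within {0..1})" and a: "a \<in> {0..1}"
  shows "lim (\<lambda>n. (h (unit_step n a) - h a) / (unit_step n a - a)) = D"
proof (rule limI)
  have "((\<lambda>y. (h y - h a) / (y - a)) \<longlongrightarrow> D) (at a within {0..1})"
    using assms(1) by (simp add: has_real_derivative_iff_has_vector_derivative[symmetric] has_field_derivative_iff)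
  moreover have "filterlim (\<lambda>n. unit_step n a) (at a within {0..1}) sequentially"
    unfolding filterlim_at using unit_step_tendsto unit_step_mem[OF a] unit_step_ne by auto
  ultimately show "(\<lambda>n. (h (unit_step n a) - h a) / (unit_step n a - a)) \<longlonglongrightarrow> D"
    by (rule filterlim_compose)
qed

text \<open>
  Where no derivative exists, \<^const>\<open>vector_derivative\<close> returns the fixed value \<open>SOME D. False\<close>,
  so Rademacher's theorem is not needed for measurability.
\<close>
lemma borel_measurable_partial:
  fixes f :: "real^'d::finite \<Rightarrow> real"
  assumes f: "continuous_on (cbox 0 1) f"
  shows "(\<lambda>s. indicator (cbox 0 1) s * partial j f s) \<in> borel_measurable borel"
proof -
  \<comment> \<open>Composition with \<open>clamp\<close> extends \<open>f\<close> continuously from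
    the cube to the whole space, so that the quotients below are Borel everywhere.\<close>
  define g where "g = (\<lambda>s. f (clamp 0 1 s))"
  have g: "continuous_on S g" for S
    unfolding g_def by (rule clamp_continuous_on[OF f])
  have [measurable]: "g \<in> borel_measurable borel"
    by (rule borel_measurable_continuous_onI[OF g])
  have line_meas [measurable]: "(\<lambda>s. line j s (w s)) \<in> borel_measurable borel"
    if [measurable]: "w \<in> borel_measurable borel" for w :: "real^'d \<Rightarrow> real"
  proof -
    have "continuous_on UNIV (\<lambda>p. line j (fst p) (snd p :: real))"
      by (intro continuous_intros)
    then have "(\<lambda>p. line j (fst p) (snd p)) \<in> borel_measurable (borel :: ((real^'d) \<times> real) measure)"
      by (rule borel_measurable_continuous_onI)
    moreover have "(\<lambda>s. (s, w s)) \<in> borel \<rightarrow>\<^sub>M borel"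
      unfolding borel_prod[symmetric] by measurable
    ultimately have "(\<lambda>s. line j (fst (s, w s)) (snd (s, w s))) \<in> borel_measurable borel"
      by (rule measurable_compose[rotated])
    then show ?thesis unfolding fst_conv snd_conv .
  qed
  \<comment> \<open>\<open>Q s\<close> is the only possible value of the derivative at a point of
    the cube. As \<open>lim\<close> is total, \<open>Q\<close> is defined and Borel even where the
    quotients diverge.\<close>
  define Q where "Q s = lim (\<lambda>n. (g (line j s (unit_step n (s $ j))) - g s) / (unit_step n (s $ j) - s $ j))" for s
  have [measurable]: "Q \<in> borel_measurable borel"
    unfolding Q_def[abs_def] by (intro borel_measurable_lim_metric) measurable
  \<comment> \<open>The countable form of the claim that \<open>Q s\<close> is the derivative; on
    the cube this amounts to the existence of a derivative.\<close>
  define E where "E s \<longleftrightarrow> (\<forall>n. \<exists>k. \<forall>q::rat. 0 \<le> real_of_rat q \<and> real_of_rat q \<le> 1 \<and>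
        \<bar>real_of_rat q - s $ j\<bar> < inverse (real (Suc k)) \<longrightarrow>
      \<bar>g (line j s (of_rat q)) - g s - Q s * (of_rat q - s $ j)\<bar> \<le> inverse (real (Suc n)) * \<bar>of_rat q - s $ j\<bar>)" for s
  have [measurable]: "Measurable.pred borel E"
    unfolding E_def[abs_def] by measurable
  have "partial j f s = (if E s then Q s else (SOME D. False))" if s: "s \<in> cbox 0 1" for s
  proof -
    have sj: "s $ j \<in> {0..1}" using s by (auto simp: mem_box_cart)
    have cont: "continuous_on {0..1} (\<lambda>u. g (line j s u))"
      by (rule continuous_on_compose2[OF g[of UNIV]]) (auto intro!: continuous_intros)
    have E: "E s \<longleftrightarrow> ((\<lambda>u. g (line j s u)) has_vector_derivative Q s) (at (s $ j) within {0..1})"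
      using has_vector_derivative_within_unit_iff_rat[OF cont sj, of "Q s"] by (simp add: E_def)
    have Q: "D = Q s" if "((\<lambda>u. g (line j s u)) has_vector_derivative D) (at (s $ j) within {0..1})" for D
      using has_vector_derivative_imp_lim_unit_step[OF that sj] by (simp add: Q_def)
    have "partial j f s = partial j g s"
      by (rule partial_cong_cube[OF _ s]) (simp add: g_def)
    also have "\<dots> = (SOME D. ((\<lambda>u. g (line j s u)) has_vector_derivative D) (at (s $ j) within {0..1}))"
      by (simp add: partial_def vector_derivative_def line_def)
    \<comment> \<open>By uniqueness the predicate under the choice operator holds for
      \<open>Q s\<close> alone or for nothing, according to \<open>E s\<close>.\<close>
    also have "(\<lambda>D. ((\<lambda>u. g (line j s u)) has_vector_derivative D) (at (s $ j) within {0..1})) =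
        (\<lambda>D. E s \<and> D = Q s)"
      using E Q by blast
    also have "(SOME D. E s \<and> D = Q s) = (if E s then Q s else (SOME D. False))"
      by simp
    finally show ?thesis .
  qed
  then have "(\<lambda>s. indicator (cbox 0 1) s * partial j f s) =
      (\<lambda>s. indicator (cbox 0 1) s * (if E s then Q s else (SOME D. False)))"
    by (auto simp: indicator_def)
  also have "\<dots> \<in> borel_measurable borel" by measurable
  finally show ?thesis .
qed

section \<open>Bounds and integrability\<close>

text \<open>Difference quotients along an axis are bounded by \<open>L\<close>, hence so is their
  limit. The maximum covers the default value at points without a derivative.\<close>

lemma partial_bounded:
  fixes f :: "real^'d::finite \<Rightarrow> real"
  assumes f: "L-lipschitz_on (cbox 0 1) f" and s: "s \<in> cbox 0 1"
  shows "\<bar>partial j f s\<bar> \<le> max L \<bar>SOME D. False\<bar>"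
proof (cases "\<exists>D. ((\<lambda>u. f (line j s u)) has_vector_derivative D) (at (s $ j) within {0..1})")
  case True
  define D where "D = partial j f s"
  have D: "((\<lambda>u. f (line j s u)) has_vector_derivative D) (at (s $ j) within {0..1})"
    using someI_ex[OF True] by (simp add: D_def partial_def vector_derivative_def line_def)
  have sj: "s $ j \<in> {0..1}" using s by (auto simp: mem_box_cart)
  have "((\<lambda>y. (f (line j s y) - f (line j s (s $ j))) / (y - s $ j)) \<longlongrightarrow> D) (at (s $ j) within {0..1})"
    using D by (simp add: has_real_derivative_iff_has_vector_derivative[symmetric] has_field_derivative_iff)
  moreover have "at (s $ j) within {0..1} \<noteq> bot"
    using sj islimpt_Icc[of 0 1 "s $ j"] by (simp add: trivial_limit_within)
  moreover have "\<forall>\<^sub>F y in at (s $ j) within {0..1}. norm ((f (line j s y) - f (line j s (s $ j))) / (y - s $ j)) \<le> L"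
    unfolding eventually_at
  proof (intro exI[of _ 1] conjI ballI impI)
    fix y assume y: "y \<in> {0..1}" "y \<noteq> s $ j \<and> dist y (s $ j) < 1"
    have "\<bar>f (line j s y) - f (line j s (s $ j))\<bar> \<le> L * \<bar>y - s $ j\<bar>"
      using lipschitz_onD[OF f line_in_cube[OF s y(1)] line_in_cube[OF s sj], of j j]
      by (simp add: dist_line dist_real_def del: line_same)
    then show "norm ((f (line j s y) - f (line j s (s $ j))) / (y - s $ j)) \<le> L"
      using y by (simp add: divide_le_eq)
  qed simp
  ultimately have "norm D \<le> L" by (intro Lim_norm_ubound)
  then show ?thesis by (simp add: D_def)
next
  case False
  then show ?thesis by (simp add: partial_def vector_derivative_def line_def)
qed

text \<open>Each term of the Leibniz expansion is Borel and bounded on the cube, which has finite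
  volume.\<close>

lemma integrable_indicator_jac_minor:
  fixes x :: "real^'d::{finite,linorder} \<Rightarrow> 'v::real_inner"
  assumes "x \<in> lip_cube"
  shows "integrable lborel (\<lambda>s. indicator (cbox 0 1) s * jac_minor e x P s)"
proof -
  obtain L where L: "L-lipschitz_on (cbox 0 1) x" using assms by (auto simp: lip_cube_def)
  define f where "f = (\<lambda>i u. e (P i) \<bullet> x u)"
  have lip: "(norm (e (P i)) * L)-lipschitz_on (cbox 0 1) (f i)" for i
  proof (rule lipschitz_onI)
    fix y z assume yz: "y \<in> cbox 0 (1 :: real^'d::{finite,linorder})" "z \<in> cbox 0 (1 :: real^'d::{finite,linorder})"
    then have "norm (x y - x z) \<le> L * dist y z" using lipschitz_onD[OF L] by (simp add: dist_norm)
    then have "norm (e (P i)) * norm (x y - x z) \<le> norm (e (P i)) * (L * dist y z)"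
      by (intro mult_left_mono) auto
    moreover have "dist (f i y) (f i z) \<le> norm (e (P i)) * norm (x y - x z)"
      using Cauchy_Schwarz_ineq2[of "e (P i)" "x y - x z"] by (simp add: f_def dist_real_def inner_diff_right)
    ultimately show "dist (f i y) (f i z) \<le> norm (e (P i)) * L * dist y z" by (simp add: mult.assoc)
  qed (use lipschitz_on_nonneg[OF L] in simp)
  define B where "B i = max (norm (e (P i)) * L) \<bar>SOME D. False\<bar>" for i
  have bound: "\<bar>partial j (f i) s\<bar> \<le> B i" if "s \<in> cbox 0 1" for i j s
    unfolding B_def by (rule partial_bounded[OF lip that])
  have meas: "(\<lambda>s. indicator (cbox 0 1) s * partial j (f i) s) \<in> borel_measurable borel" for i j
    by (rule borel_measurable_partial[OF lipschitz_on_continuous_on[OF lip]])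
  \<comment> \<open>Repeating the indicator in every factor changes nothing on the cube and makes
    each factor Borel on the whole space.\<close>
  have jac: "indicator (cbox 0 1) s * jac_minor e x P s =
    (\<Sum>p | p permutes UNIV. indicator (cbox 0 1) s * (of_int (sign p) * (\<Prod>i\<in>UNIV. indicator (cbox 0 1) s * partial (p i) (f i) s)))" for s
    by (auto simp: jac_minor_def det_def f_def indicator_def)
  show ?thesis
    unfolding jac
  proof (intro Bochner_Integration.integrable_sum)
    fix p :: "'d \<Rightarrow> 'd"
    have "(\<lambda>s. of_int (sign p) * (\<Prod>i\<in>UNIV. indicator (cbox 0 1) s * partial (p i) (f i) s)) \<in> borel_measurable lborel"
      using meas by simp
    moreover have "\<bar>of_int (sign p) * (\<Prod>i\<in>UNIV. indicator (cbox 0 1) s * partial (p i) (f i) s)\<bar> \<le> (\<Prod>i\<in>UNIV. B i)"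
      if "s \<in> cbox 0 1" for s
      using that bound by (auto simp: abs_mult sign_def abs_prod intro!: prod_mono)
    ultimately have "integrable lborel (\<lambda>s. indicator (cbox 0 1) s *\<^sub>R (of_int (sign p) * (\<Prod>i\<in>UNIV. indicator (cbox 0 1) s * partial (p i) (f i) s)))"
      by (intro integrableI_bounded_set_indicator[where B = "\<Prod>i\<in>UNIV. B i"])
        (auto simp: emeasure_lborel_cbox_eq)
    then show "integrable lborel (\<lambda>s. indicator (cbox 0 1) s * (of_int (sign p) * (\<Prod>i\<in>UNIV. indicator (cbox 0 1) s * partial (p i) (f i) s)))"
      by simp
  qed
qed

subsection \<open>Integration over products of simplices\<close>

lemma concat_seq_le: "i \<le> m \<Longrightarrow> concat_seq m s t i = s i"
  by (simp add: concat_seq_def)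

lemma concat_seq_add: "1 \<le> i \<Longrightarrow> concat_seq m s t (m + i) = t i"
  by (simp add: concat_seq_def)

lemma prod_atLeastAtMost_add:
  fixes f :: "nat \<Rightarrow> 'a::comm_monoid_mult"
  shows "(\<Prod>i=1..m + n. f i) = (\<Prod>i=1..m. f i) * (\<Prod>i=1..n. f (m + i))"
proof -
  have "(\<Prod>i=1..m + n. f i) = (\<Prod>i=1..m. f i) * (\<Prod>i\<in>(+) m ` {1..n}. f i)"
    unfolding atLeastAtMost_add_eq by (rule prod.union_disjoint) auto
  also have "(\<Prod>i\<in>(+) m ` {1..n}. f i) = (\<Prod>i=1..n. f (m + i))"
    by (subst prod.reindex) simp_all
  finally show ?thesis .
qed

text \<open>A finite product measure is determined by its values on boxes, and the preimage of a box
  under concatenation is a product of two boxes. \<open>restrict\<close> yields the extensional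
  functions that form the space of \<open>PiM\<close>.\<close>

lemma distr_concat_seq:
  fixes N :: "'a measure"
  assumes "sigma_finite_measure N"
  shows "distr (PiM {1..m} (\<lambda>_. N) \<Otimes>\<^sub>M PiM {1..n} (\<lambda>_. N)) (PiM {1..m + n} (\<lambda>_. N))
      (\<lambda>(s, t). restrict (concat_seq m s t) {1..m + n}) = PiM {1..m + n} (\<lambda>_. N)"
    (is "distr ?P _ ?h = _")
    and "(\<lambda>(s, t). restrict (concat_seq m s t) {1..m + n})
      \<in> PiM {1..m} (\<lambda>_. N) \<Otimes>\<^sub>M PiM {1..n} (\<lambda>_. N) \<rightarrow>\<^sub>M PiM {1..m + n} (\<lambda>_. N)"
proof -
  interpret N: sigma_finite_measure N by fact
  interpret product_sigma_finite "\<lambda>_. N" by standard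
  interpret I: finite_product_sigma_finite "\<lambda>_. N" "{1..m}" by standard simp
  interpret J: finite_product_sigma_finite "\<lambda>_. N" "{1..n}" by standard simp
  show meas: "?h \<in> ?P \<rightarrow>\<^sub>M PiM {1..m + n} (\<lambda>_. N)"
    unfolding case_prod_beta
  proof (rule measurable_restrict)
    fix i assume i: "i \<in> {1..m + n}"
    show "(\<lambda>p. concat_seq m (fst p) (snd p) i) \<in> ?P \<rightarrow>\<^sub>M N"
    proof (cases "i \<le> m")
      case True
      then have "(\<lambda>s. s i) \<in> PiM {1..m} (\<lambda>_. N) \<rightarrow>\<^sub>M N"
        using i by (intro measurable_component_singleton) auto
      from measurable_compose[OF measurable_fst this] show ?thesis
        using True by (simp add: concat_seq_def)
    next
      case False
      then have "(\<lambda>t. t (i - m)) \<in> PiM {1..n} (\<lambda>_. N) \<rightarrow>\<^sub>M N"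
        using i by (intro measurable_component_singleton) auto
      from measurable_compose[OF measurable_snd this] show ?thesis
        using False by (simp add: concat_seq_def)
    qed
  qed
  show "distr ?P (PiM {1..m + n} (\<lambda>_. N)) ?h = PiM {1..m + n} (\<lambda>_. N)"
  proof (rule PiM_eqI)
    fix A assume A: "\<And>i. i \<in> {1..m + n} \<Longrightarrow> A i \<in> sets N"
    have "A i \<subseteq> space N" if "i \<in> {1..m + n}" for i using A[OF that] sets.sets_into_space by blast
    then have sub: "\<forall>i\<in>{1..m}. A i \<subseteq> space N" "\<forall>i\<in>{1..n}. A (m + i) \<subseteq> space N"
      by auto
    have vimage: "?h -` Pi\<^sub>E {1..m + n} A \<inter> space ?P = Pi\<^sub>E {1..m} A \<times> Pi\<^sub>E {1..n} (\<lambda>i. A (m + i))"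
    proof (rule set_eqI)
      fix p :: "(nat \<Rightarrow> 'a) \<times> (nat \<Rightarrow> 'a)"
      obtain s t where p: "p = (s, t)" by (cases p)
      \<comment> \<open>Membership in the sides of the box implies membership in
        \<open>space N\<close>, so the space condition in the preimage is absorbed.\<close>
      have space: "(\<forall>i\<in>{1..m}. s i \<in> A i) \<longrightarrow> (\<forall>i\<in>{1..m}. s i \<in> space N)"
        "(\<forall>i\<in>{1..n}. t i \<in> A (m + i)) \<longrightarrow> (\<forall>i\<in>{1..n}. t i \<in> space N)"
        using sub by (meson subsetD)+
      have "p \<in> ?h -` Pi\<^sub>E {1..m + n} A \<inter> space ?P \<longleftrightarrow>
          (\<forall>i\<in>{1..m + n}. concat_seq m s t i \<in> A i) \<and> (\<forall>i\<in>{1..m}. s i \<in> space N) \<and> s \<in> extensional {1..m} \<and>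
          (\<forall>i\<in>{1..n}. t i \<in> space N) \<and> t \<in> extensional {1..n}"
        by (auto simp: p space_pair_measure space_PiM PiE_iff)
      also have "(\<forall>i\<in>{1..m + n}. concat_seq m s t i \<in> A i) \<longleftrightarrow>
          (\<forall>i\<in>{1..m}. s i \<in> A i) \<and> (\<forall>i\<in>{1..n}. t i \<in> A (m + i))"
        unfolding ball_atLeastAtMost_add by (simp add: concat_seq_le concat_seq_add)
      finally show "p \<in> ?h -` Pi\<^sub>E {1..m + n} A \<inter> space ?P \<longleftrightarrow>
          p \<in> Pi\<^sub>E {1..m} A \<times> Pi\<^sub>E {1..n} (\<lambda>i. A (m + i))"
        unfolding p mem_Times_iff fst_conv snd_conv PiE_iff using space by argo
    qed
    have "emeasure (distr ?P (PiM {1..m + n} (\<lambda>_. N)) ?h) (Pi\<^sub>E {1..m + n} A) =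
        emeasure ?P (Pi\<^sub>E {1..m} A \<times> Pi\<^sub>E {1..n} (\<lambda>i. A (m + i)))"
      unfolding vimage[symmetric]
      by (rule emeasure_distr[OF meas sets_PiM_I_finite]) (auto intro!: A)
    also have "\<dots> = emeasure (PiM {1..m} (\<lambda>_. N)) (Pi\<^sub>E {1..m} A) *
        emeasure (PiM {1..n} (\<lambda>_. N)) (Pi\<^sub>E {1..n} (\<lambda>i. A (m + i)))"
      by (intro J.emeasure_pair_measure_Times sets_PiM_I_finite) (auto intro!: A)
    also have "\<dots> = (\<Prod>i\<in>{1..m + n}. emeasure N (A i))"
      unfolding prod_atLeastAtMost_add
      by (subst (1 2) emeasure_PiM) (auto intro!: A)
    finally show "emeasure (distr ?P (PiM {1..m + n} (\<lambda>_. N)) ?h) (Pi\<^sub>E {1..m + n} A) =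
        (\<Prod>i\<in>{1..m + n}. emeasure N (A i))" .
  qed simp_all
qed

text \<open>Fubini after transport along concatenation: integrability of \<open>F\<close> passes to
  the pair, and \<open>f s\<close> then leaves the inner integral.\<close>

lemma integral_PiM_concat_seq:
  fixes f g F :: "(nat \<Rightarrow> 'a) \<Rightarrow> real"
  assumes N: "sigma_finite_measure N"
    and F: "integrable (PiM {1..m + n} (\<lambda>_. N)) F"
    and eq: "\<And>s t. F (restrict (concat_seq m s t) {1..m + n}) = f s * g t"
  shows "(\<integral>t. F t \<partial>PiM {1..m + n} (\<lambda>_. N)) =
    (\<integral>s. f s \<partial>PiM {1..m} (\<lambda>_. N)) * (\<integral>t. g t \<partial>PiM {1..n} (\<lambda>_. N))"
proof -
  interpret N: sigma_finite_measure N by fact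
  interpret product_sigma_finite "\<lambda>_. N" by standard
  interpret I: finite_product_sigma_finite "\<lambda>_. N" "{1..m}" by standard simp
  interpret J: finite_product_sigma_finite "\<lambda>_. N" "{1..n}" by standard simp
  interpret P: pair_sigma_finite "PiM {1..m} (\<lambda>_. N)" "PiM {1..n} (\<lambda>_. N)" ..
  let ?P = "PiM {1..m} (\<lambda>_. N) \<Otimes>\<^sub>M PiM {1..n} (\<lambda>_. N)"
  let ?h = "\<lambda>(s, t). restrict (concat_seq m s t) {1..m + n}"
  note d = distr_concat_seq[OF N, of m n]
  have Fm: "F \<in> borel_measurable (PiM {1..m + n} (\<lambda>_. N))" using F by auto
  have int: "integrable ?P (\<lambda>p. F (?h p))"
    by (rule integrable_distr[OF d(2)]) (simp only: d(1) F)
  have "(\<integral>t. F t \<partial>PiM {1..m + n} (\<lambda>_. N)) = (\<integral>p. F (?h p) \<partial>?P)"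
    by (subst d(1)[symmetric], rule integral_distr[OF d(2) Fm])
  also have "\<dots> = (\<integral>s. (\<integral>t. F (?h (s, t)) \<partial>PiM {1..n} (\<lambda>_. N)) \<partial>PiM {1..m} (\<lambda>_. N))"
    by (rule P.integral_fst'[OF int, symmetric])
  also have "\<dots> = (\<integral>s. f s * (\<integral>t. g t \<partial>PiM {1..n} (\<lambda>_. N)) \<partial>PiM {1..m} (\<lambda>_. N))"
    unfolding case_prod_conv eq by simp
  finally show ?thesis by simp
qed

section \<open>Points sharing a coordinate form a null set\<close>

text \<open>With all points but the \<open>i\<close>-th fixed, equality confines that point to a
  hyperplane, which is null; Tonelli does the rest.\<close>

lemma AE_PiM_lborel_nth_neq:
  fixes I :: "'i set"
  assumes I: "finite I" "i \<in> I" "k \<in> I" "i \<noteq> k"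
  shows "AE t in PiM I (\<lambda>_. lborel :: (real^'d::finite) measure). t i $ j \<noteq> t k $ j"
proof -
  interpret product_sigma_finite "\<lambda>_::'i. lborel :: (real^'d) measure" by standard
  let ?M = "\<lambda>I. PiM I (\<lambda>_. lborel :: (real^'d) measure)"
  let ?A = "{t \<in> space (?M I). t i $ j = t k $ j}"
  have [measurable]: "(\<lambda>t. t l $ j) \<in> borel_measurable (?M I)" if "l \<in> I" for l
    by (rule measurable_compose[OF measurable_component_singleton[OF that]]) simp
  have A: "?A \<in> sets (?M I)"
    using I by measurable
  have ins: "insert i (I - {i}) = I" using I by auto
  have hyper: "emeasure lborel {y::real^'d. y $ j = c} = 0" for c
  proof -
    have "closed {y::real^'d. y $ j = c}" by (intro closed_Collect_eq continuous_intros)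
    then have "{y::real^'d. y $ j = c} \<in> sets lborel" by simp
    moreover have "emeasure lebesgue {y::real^'d. y $ j = c} = 0"
      using negligible_standard_hyperplane[of "axis j (1::real)" c]
      by (simp add: axis_in_Basis_iff cart_eq_inner_axis negligible_iff_null_sets null_setsD1)
    ultimately show ?thesis by simp
  qed
  have "emeasure (?M I) ?A = (\<integral>\<^sup>+ t. indicator ?A t \<partial>?M (insert i (I - {i})))"
    unfolding ins using A by simp
  also have "\<dots> = (\<integral>\<^sup>+ t. (\<integral>\<^sup>+ y. indicator ?A (t(i := y)) \<partial>lborel) \<partial>?M (I - {i}))"
    by (rule product_nn_integral_insert) (use I A ins in auto)
  also have "\<dots> = (\<integral>\<^sup>+ t. 0 \<partial>?M (I - {i}))"
  proof (rule nn_integral_cong)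
    fix t
    \<comment> \<open>Since \<open>i \<noteq> k\<close>, the update \<open>t(i := y)\<close> leaves
      \<open>t k\<close> unchanged.\<close>
    have "(\<integral>\<^sup>+ y. indicator ?A (t(i := y)) \<partial>lborel) \<le> (\<integral>\<^sup>+ y. indicator {y. y $ j = t k $ j} y \<partial>lborel)"
      using I by (intro nn_integral_mono) (auto simp: indicator_def)
    also have "\<dots> = emeasure lborel {y::real^'d. y $ j = t k $ j}"
      by (rule nn_integral_indicator) (auto intro!: closed_Collect_eq continuous_intros borel_closed)
    finally show "(\<integral>\<^sup>+ y. indicator ?A (t(i := y)) \<partial>lborel) = 0" by (simp add: hyper)
  qed
  finally have "emeasure (?M I) ?A = 0" by simp
  then show ?thesis
    using A by (intro AE_I[where N = ?A]) auto
qed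

lemma AE_PiM_lborel_inj_on_nth:
  "AE t in PiM {1..N::nat} (\<lambda>_. lborel :: (real^'d::finite) measure). \<forall>j. inj_on (\<lambda>i. t i $ j) {1..N}"
proof -
  have "AE t in PiM {1..N} (\<lambda>_. lborel :: (real^'d::finite) measure).
      \<forall>j. \<forall>i\<in>{1..N}. \<forall>k\<in>{1..N}. i \<noteq> k \<longrightarrow> t i $ j \<noteq> t k $ j"
    unfolding AE_all_countable
    by (auto intro!: AE_finite_allI AE_PiM_lborel_nth_neq)
  then show ?thesis
    by eventually_elim (auto simp: inj_on_def)
qed

text \<open>The family \<open>X\<close> lets this apply both to \<open>t\<close> and to its shifted
  second block. Membership is a finite conjunction of inequalities between coordinates, and
  \<open>\<pi> j\<close> keeps their indices in \<open>{1..m}\<close>.\<close>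

lemma pred_prod_simplex:
  fixes X :: "nat \<Rightarrow> 'a \<Rightarrow> real^'d::finite"
  assumes X [measurable]: "\<And>i. i \<in> {1..m} \<Longrightarrow> X i \<in> borel_measurable M"
    and \<pi>: "\<And>j. \<pi> j permutes {1..m}"
  shows "Measurable.pred M (\<lambda>\<omega>. (\<lambda>i. X i \<omega>) \<in> prod_simplex m \<pi>)"
proof -
  have \<pi>': "\<pi> j i \<in> {1..m}" if "i \<in> {1..m}" for i j
    using permutes_in_image[OF \<pi>] that by blast
  have [measurable]: "(\<lambda>\<omega>. X i \<omega> $ j) \<in> borel_measurable M" if "i \<in> {1..m}" for i j
    by (rule measurable_compose[OF X[OF that]]) simp
  have [measurable]: "(\<lambda>\<omega>. X (\<pi> j i) \<omega> $ j) \<in> borel_measurable M" if "i \<in> {1..m}" for i j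
    by (rule measurable_compose[OF X[OF \<pi>'[OF that]]]) simp
  have *: "(\<lambda>i. X i \<omega>) \<in> prod_simplex m \<pi> \<longleftrightarrow> (\<forall>j. (\<forall>i\<in>{1..m}. 0 \<le> X i \<omega> $ j \<and> X i \<omega> $ j \<le> 1) \<and>
      (\<forall>i\<in>{1..m}. \<forall>k\<in>{1..m}. i < k \<longrightarrow> X (\<pi> j i) \<omega> $ j < X (\<pi> j k) \<omega> $ j))" for \<omega>
    by (auto simp: prod_simplex_def simplex_perm_def strict_mono_on_def)
  show ?thesis
    unfolding * by measurable
qed

lemma prod_simplex_cong:
  fixes s t :: "nat \<Rightarrow> real^'d::finite"
  assumes \<pi>: "\<And>j. \<pi> j permutes {1..m}" and eq: "\<And>i. i \<in> {1..m} \<Longrightarrow> s i = t i"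
  shows "s \<in> prod_simplex m \<pi> \<longleftrightarrow> t \<in> prod_simplex m \<pi>"
proof -
  have \<pi>': "\<pi> j i \<in> {1..m}" if "i \<in> {1..m}" for i j
    using permutes_in_image[OF \<pi>] that by blast
  have "t' \<in> prod_simplex m \<pi>" if s': "s' \<in> prod_simplex m \<pi>" and "\<And>i. i \<in> {1..m} \<Longrightarrow> s' i = t' i"
    for s' t' :: "nat \<Rightarrow> real^'d"
    using that \<pi>' unfolding prod_simplex_def simplex_perm_def strict_mono_on_def by auto
  from this[of s t] this[of t s] show ?thesis using eq by auto
qed

text \<open>The cube indicators make every factor integrable over the whole space; on
  \<open>prod_simplex\<close> they all equal 1.\<close>

definition monomial_integrand ::
    "(nat \<Rightarrow> 'v::real_inner) \<Rightarrow> nat \<Rightarrow> (nat \<Rightarrow> 'd::{finite,linorder} \<Rightarrow> nat) \<Rightarrow>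
      ((real^'d::{finite,linorder}) \<Rightarrow> 'v) \<Rightarrow> (nat \<Rightarrow> real^'d::{finite,linorder}) \<Rightarrow> real" where
  "monomial_integrand e m P x t =
    (\<Prod>i=1..m. indicator (cbox 0 1) (t i) * jac_minor e x (P i) (t i))"

lemma integrable_monomial_integrand:
  assumes "x \<in> lip_cube"
  shows "integrable (PiM {1..m} (\<lambda>_. lborel)) (monomial_integrand e m P x)"
proof -
  interpret product_sigma_finite "\<lambda>_::nat. lborel :: (real^'d::{finite,linorder}) measure" by standard
  show ?thesis
    unfolding monomial_integrand_def[abs_def]
    by (rule product_integrable_prod) (auto intro: integrable_indicator_jac_minor[OF assms])
qed

text \<open>With the indicators the integrand is measurable for the uncompleted product, so its
  integrals over \<open>PiM\<close> and over the completion agree.\<close>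

lemma
  fixes P :: "nat \<Rightarrow> 'd::{finite,linorder} \<Rightarrow> nat"
  assumes x: "x \<in> lip_cube" and \<pi>: "\<And>j. \<pi> j permutes {1..m}"
  shows integrable_indicator_monomial_integrand:
    "integrable (PiM {1..m} (\<lambda>_. lborel))
      (\<lambda>t. indicator (prod_simplex m \<pi>) t * monomial_integrand e m P x t)" (is ?int)
    and mapping_monomial_eq_integral_PiM:
    "mapping_monomial e m P \<pi> x =
      (\<integral>t. indicator (prod_simplex m \<pi>) t * monomial_integrand e m P x t \<partial>PiM {1..m} (\<lambda>_. lborel))"
proof -
  let ?M = "PiM {1..m} (\<lambda>_. lborel) :: (nat \<Rightarrow> real^'d::{finite,linorder}) measure"
  have "Measurable.pred ?M (\<lambda>t. (\<lambda>i. t i) \<in> prod_simplex m \<pi>)"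
    by (rule pred_prod_simplex[OF _ \<pi>])
      (use measurable_component_singleton[of _ "{1..m}" "\<lambda>_. lborel"] in simp)
  \<comment> \<open>\<open>prod_simplex m \<pi>\<close> also contains functions that are not
    extensional, so measurability is claimed only for its trace on the space.\<close>
  then have "{t \<in> space ?M. t \<in> prod_simplex m \<pi>} \<in> sets ?M" by (simp add: pred_def)
  from integrable_mult_indicator[OF this integrable_monomial_integrand[OF x, of m e P]]
  show int: ?int
    by (rule Bochner_Integration.integrable_cong[THEN iffD1, rotated 2]) (auto simp: indicator_def)
  have cube: "t i \<in> cbox 0 1" if "t \<in> prod_simplex m \<pi>" "i \<in> {1..m}" for t i
    using that by (auto simp: prod_simplex_def simplex_perm_def mem_box_cart)
  have "mapping_monomial e m P \<pi> x =
      (\<integral>t. indicator (prod_simplex m \<pi>) t * monomial_integrand e m P x t \<partial>completion ?M)"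
    unfolding mapping_monomial_def set_lebesgue_integral_def
    by (intro Bochner_Integration.integral_cong refl)
      (auto simp: indicator_def monomial_integrand_def cube intro!: prod.cong)
  also have "\<dots> = (\<integral>t. indicator (prod_simplex m \<pi>) t * monomial_integrand e m P x t \<partial>?M)"
    by (rule integral_completion[OF borel_measurable_integrable[OF int]])
  finally show "mapping_monomial e m P \<pi> x = \<dots>" .
qed

section \<open>The shuffle identity\<close>

theorem theorem1:
  fixes e :: "nat \<Rightarrow> 'v::real_inner"
    and n m1 m2 :: nat
    and P1 P2 :: "nat \<Rightarrow> 'd::{finite,linorder} \<Rightarrow> nat"
    and \<pi>1 \<pi>2 :: "'d \<Rightarrow> nat \<Rightarrow> nat"
    and x :: "(real^'d::{finite,linorder}) \<Rightarrow> 'v"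
  assumes onb: "is_onb n e"
    and P1: "\<And>i. i \<in> {1..m1} \<Longrightarrow> P1 i \<in> order_inj n"
    and P2: "\<And>i. i \<in> {1..m2} \<Longrightarrow> P2 i \<in> order_inj n"
    and \<pi>1: "\<And>j. \<pi>1 j permutes {1..m1}"
    and \<pi>2: "\<And>j. \<pi>2 j permutes {1..m2}"
    and x: "x \<in> lip_cube"
  defines "P \<equiv> concat_seq m1 P1 P2"
    and "\<pi> \<equiv> (\<lambda>j. perm_sum m1 (\<pi>1 j) (\<pi>2 j))"
  shows "mapping_monomial e m1 P1 \<pi>1 x * mapping_monomial e m2 P2 \<pi>2 x =
    (\<Sum>\<sigma> | \<forall>j. \<sigma> j \<in> Sh m1 m2. mapping_monomial e (m1 + m2) P (\<lambda>j. \<pi> j \<circ> \<sigma> j) x)"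
proof -
  let ?M = "PiM {1..m1 + m2} (\<lambda>_. lborel) :: (nat \<Rightarrow> real^'d::{finite,linorder}) measure"
  define J where "J = monomial_integrand e (m1 + m2) P x"
  \<comment> \<open>\<open>F\<close> is the integrand of the left-hand product on the concatenated
    space; \<open>f \<sigma>\<close> below is that of one summand on the right.\<close>
  define F where "F t = indicator (prod_simplex m1 \<pi>1) t *
    indicator (prod_simplex m2 \<pi>2) (\<lambda>i. t (m1 + i)) * J t" for t
  define S where "S = {\<sigma>. \<forall>j::'d. \<sigma> j \<in> Sh m1 m2}"
  define f where "f \<sigma> t = indicator (prod_simplex (m1 + m2) (\<lambda>j. \<pi> j \<circ> \<sigma> j)) t * J t" for \<sigma> t
  have perm: "(\<pi> j \<circ> \<sigma> j) permutes {1..m1 + m2}" if "\<sigma> \<in> S" for \<sigma> j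
    using that perm_sum_permutes[OF \<pi>1 \<pi>2] by (auto simp: S_def Sh_def \<pi>_def intro: permutes_compose)
  have int_f: "integrable ?M (f \<sigma>)" if "\<sigma> \<in> S" for \<sigma>
    using integrable_indicator_monomial_integrand[OF x perm[OF that]] by (simp add: f_def[abs_def] J_def)
  have comp: "(\<lambda>t. t i) \<in> borel_measurable ?M" if "i \<in> {1..m1 + m2}" for i
    using measurable_component_singleton[OF that, of "\<lambda>_. lborel"] by simp
  have [measurable]: "J \<in> borel_measurable ?M"
    unfolding J_def by (rule borel_measurable_integrable[OF integrable_monomial_integrand[OF x]])
  have [measurable]: "Measurable.pred ?M (\<lambda>t. (\<lambda>i. t i) \<in> prod_simplex m1 \<pi>1)"
    by (rule pred_prod_simplex[OF _ \<pi>1]) (rule comp, auto)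
  have [measurable]: "Measurable.pred ?M (\<lambda>t. (\<lambda>i. t (m1 + i)) \<in> prod_simplex m2 \<pi>2)"
    by (rule pred_prod_simplex[OF _ \<pi>2]) (rule comp, auto)
  have F_meas: "F \<in> borel_measurable ?M"
  proof -
    have "F = (\<lambda>t. (if t \<in> prod_simplex m1 \<pi>1 then 1 else 0) *
      (if (\<lambda>i. t (m1 + i)) \<in> prod_simplex m2 \<pi>2 then 1 else 0) * J t)"
      by (auto simp: F_def indicator_def)
    also have "\<dots> \<in> borel_measurable ?M" by measurable
    finally show ?thesis .
  qed
  \<comment> \<open>The indicator identity holds off the null set of shared coordinates; multiplying
    by \<open>J\<close> gives the integrands.\<close>
  have AE: "AE t in ?M. (\<Sum>\<sigma>\<in>S. f \<sigma> t) = F t"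
    using AE_PiM_lborel_inj_on_nth
  proof eventually_elim
    case (elim t)
    then have "(\<Sum>\<sigma>\<in>S. indicator (prod_simplex (m1 + m2) (\<lambda>j. \<pi> j \<circ> \<sigma> j)) t) =
      indicator (prod_simplex m1 \<pi>1) t * (indicator (prod_simplex m2 \<pi>2) (\<lambda>i. t (m1 + i)) :: real)"
      unfolding S_def \<pi>_def by (intro sum_indicator_prod_simplex \<pi>1 \<pi>2) auto
    then show ?case
      by (simp add: f_def F_def sum_distrib_right[symmetric])
  qed
  have sum_int: "integrable ?M (\<lambda>t. \<Sum>\<sigma>\<in>S. f \<sigma> t)"
    by (rule Bochner_Integration.integrable_sum[OF int_f])
  \<comment> \<open>\<open>F\<close> inherits integrability from the finite sum with which it agrees
    almost everywhere.\<close>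
  then have F_int: "integrable ?M F"
    using integrable_cong_AE[OF borel_measurable_integrable[OF sum_int] F_meas AE] by simp
  \<comment> \<open>At a concatenated point the domain conditions and the product of minors split by
    blocks, as Fubini requires.\<close>
  have F_concat: "F (restrict (concat_seq m1 s t) {1..m1 + m2}) =
      (indicator (prod_simplex m1 \<pi>1) s * monomial_integrand e m1 P1 x s) *
      (indicator (prod_simplex m2 \<pi>2) t * monomial_integrand e m2 P2 x t)" for s t
  proof -
    let ?c = "restrict (concat_seq m1 s t) {1..m1 + m2}"
    have "?c \<in> prod_simplex m1 \<pi>1 \<longleftrightarrow> s \<in> prod_simplex m1 \<pi>1"
      by (rule prod_simplex_cong[OF \<pi>1]) (auto simp: concat_seq_le)
    moreover have "(\<lambda>i. ?c (m1 + i)) \<in> prod_simplex m2 \<pi>2 \<longleftrightarrow> t \<in> prod_simplex m2 \<pi>2"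
      by (rule prod_simplex_cong[OF \<pi>2]) (auto simp: concat_seq_add)
    moreover have "J ?c = monomial_integrand e m1 P1 x s * monomial_integrand e m2 P2 x t"
      unfolding J_def monomial_integrand_def prod_atLeastAtMost_add
      by (intro arg_cong2[where f = times] prod.cong refl)
        (simp_all add: P_def concat_seq_le concat_seq_add)
    ultimately show ?thesis by (simp add: F_def indicator_def)
  qed
  have "mapping_monomial e m1 P1 \<pi>1 x * mapping_monomial e m2 P2 \<pi>2 x = (\<integral>t. F t \<partial>?M)"
    unfolding mapping_monomial_eq_integral_PiM[OF x \<pi>1] mapping_monomial_eq_integral_PiM[OF x \<pi>2]
    by (rule integral_PiM_concat_seq[OF _ F_int F_concat, symmetric]) (rule lborel.sigma_finite_measure_axioms)
  also have "\<dots> = (\<integral>t. (\<Sum>\<sigma>\<in>S. f \<sigma> t) \<partial>?M)"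
    by (rule integral_cong_AE[OF borel_measurable_integrable[OF sum_int] F_meas AE, symmetric])
  also have "\<dots> = (\<Sum>\<sigma>\<in>S. \<integral>t. f \<sigma> t \<partial>?M)"
    by (rule Bochner_Integration.integral_sum[OF int_f])
  also have "\<dots> = (\<Sum>\<sigma>\<in>S. mapping_monomial e (m1 + m2) P (\<lambda>j. \<pi> j \<circ> \<sigma> j) x)"
    unfolding f_def J_def
    by (intro sum.cong refl mapping_monomial_eq_integral_PiM[OF x perm, symmetric])
  finally show ?thesis by (simp add: S_def)
qed

end
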